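(* Let $S:\mathbb{R}^n\times\mathbb{R}^m\to\mathbb{R}$ be convex-concave and continuously differentiable, and suppose that $S$ has at least one saddle point. Let $\rho>0$ and, for $x,z\in\mathbb{R}^n$ and $y,w\in\mathbb{R}^m$, define $$S_\rho(x,z,y,w):=\frac{1}{2\rho}\|x-z\|^2+S(x,y)-\frac{1}{2\rho}\|y-w\|^2 .$$ Then the regularized saddle flow dynamics $$\dot x=-\nabla_xS(x,y)-\tfrac1\rho(x-z),\quad \dot z=\tfrac1\rho(x-z),\quad \dot y=+\nabla_yS(x,y)-\tfrac1\rho(y-w),\quad \dot w=\tfrac1\rho(y-w)$$ asymptotically converge to some saddle point $(x_\star,z_\star,y_\star,w_\star)$ of $S_\rho$, with $(x_\star,y_\star)$ being a saddle point of $S$; that is, for every trajectory $(x(t),z(t),y(t),w(t))$, $t\ge0$, there is a saddle point $(x_\star,z_\star,y_\star,w_\star)$ of $S_\rho$ such that $(x(t),z(t),y(t),w(t))\to(x_\star,z_\star,y_\star,w_\star)$ as $t\to\infty$ and $(x_\star,y_\star)$ is a saddle point of $S$.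
   Context: $\|\cdot\|$ is the Euclidean norm; $\nabla_x S,\nabla_y S$ denote the (column) partial gradients. Convex-concave: $S(\cdot,y)$ is convex for every $y\in\mathbb{R}^m$ and $S(x,\cdot)$ is concave for every $x\in\mathbb{R}^n$. Saddle point of $S$: a point $(x_\star,y_\star)$ such that $S(x_\star,y)\le S(x_\star,y_\star)\le S(x,y_\star)$ for all $x\in\mathbb{R}^n$, $y\in\mathbb{R}^m$. Saddle point of $S_\rho$ (minimization in $(x,z)$, maximization in $(y,w)$): a point $(x_\star,z_\star,y_\star,w_\star)$ such that $S_\rho(x_\star,z_\star,y,w)\le S_\rho(x_\star,z_\star,y_\star,w_\star)\le S_\rho(x,z,y_\star,w_\star)$ for all $x,z\in\mathbb{R}^n$, $y,w\in\mathbb{R}^m$. *)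

theory Defs
  imports "HOL-Analysis.Analysis"
begin

definition convex_concave :: "('a::real_vector \<Rightarrow> 'b::real_vector \<Rightarrow> real) \<Rightarrow> bool" where
  "convex_concave S \<longleftrightarrow>
     (\<forall>y. convex_on UNIV (\<lambda>x. S x y)) \<and> (\<forall>x. concave_on UNIV (\<lambda>y. S x y))"

text \<open>Continuity of the derivative is with respect to the operator norm.\<close>

definition continuously_differentiable :: "('a::real_normed_vector \<Rightarrow> 'b::real_normed_vector) \<Rightarrow> bool" where
  "continuously_differentiable f \<longleftrightarrow>
     (\<exists>f' :: 'a \<Rightarrow> 'a \<Rightarrow>\<^sub>L 'b.
        (\<forall>p. (f has_derivative blinfun_apply (f' p)) (at p)) \<and> continuous_on UNIV f')"

text \<open>The value is unspecified at points where the function is not differentiable.\<close>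

definition gradient :: "('a::real_inner \<Rightarrow> real) \<Rightarrow> 'a \<Rightarrow> 'a" where
  "gradient f x = (THE D. GDERIV f x :> D)"

lemma gradient_eqI:
  assumes "GDERIV f x :> D"
  shows "gradient f x = D"
  unfolding gradient_def
proof (rule the_equality)
  fix E assume E: "GDERIV f x :> E"
  have "(\<lambda>h. inner h E) = (\<lambda>h. inner h D)"
    by (rule has_derivative_unique[OF E[unfolded gderiv_def] assms[unfolded gderiv_def]])
  then have "inner (E - D) E = inner (E - D) D"
    by (rule fun_cong)
  then have "inner (E - D) (E - D) = 0"
    by (simp only: inner_diff_right diff_self)
  then show "E = D"
    by simp
qed (rule assms)

definition saddle_point :: "('a \<Rightarrow> 'b \<Rightarrow> real) \<Rightarrow> 'a \<Rightarrow> 'b \<Rightarrow> bool" where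
  "saddle_point S xs ys \<longleftrightarrow> (\<forall>x y. S xs y \<le> S xs ys \<and> S xs ys \<le> S x ys)"

text \<open>The minimization variables \<open>(x, z)\<close> form the first argument and the maximization
  variables \<open>(y, w)\<close> the second, so that \<open>saddle_point\<close> applies.\<close>

definition regularized ::
    "('a::real_normed_vector \<Rightarrow> 'b::real_normed_vector \<Rightarrow> real) \<Rightarrow> real
       \<Rightarrow> 'a \<times> 'a \<Rightarrow> 'b \<times> 'b \<Rightarrow> real" where
  "regularized S \<rho> = (\<lambda>(x, z) (y, w).
     1 / (2 * \<rho>) * (norm (x - z))\<^sup>2 + S x y - 1 / (2 * \<rho>) * (norm (y - w))\<^sup>2)"

text \<open>Trajectories are classical solutions on \<open>[0, \<infinity>)\<close>; the derivative at \<open>0\<close> is one-sided.\<close>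

definition regularized_saddle_flow ::
    "('a::real_inner \<Rightarrow> 'b::real_inner \<Rightarrow> real) \<Rightarrow> real
       \<Rightarrow> (real \<Rightarrow> 'a) \<Rightarrow> (real \<Rightarrow> 'a) \<Rightarrow> (real \<Rightarrow> 'b) \<Rightarrow> (real \<Rightarrow> 'b) \<Rightarrow> bool" where
  "regularized_saddle_flow S \<rho> x z y w \<longleftrightarrow> (\<forall>t\<ge>0.
     (x has_vector_derivative
        - gradient (\<lambda>u. S u (y t)) (x t) - (1 / \<rho>) *\<^sub>R (x t - z t)) (at t within {0..}) \<and>
     (z has_vector_derivative (1 / \<rho>) *\<^sub>R (x t - z t)) (at t within {0..}) \<and>
     (y has_vector_derivative
        gradient (\<lambda>v. S (x t) v) (y t) - (1 / \<rho>) *\<^sub>R (y t - w t)) (at t within {0..}) \<and>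
     (w has_vector_derivative (1 / \<rho>) *\<^sub>R (y t - w t)) (at t within {0..}))"

end

theory Submission
  imports Defs
begin

text \<open>Write \<open>p = (x, y)\<close>, \<open>q = (z, w)\<close> and \<open>F = (\<nabla>\<^sub>x S, - \<nabla>\<^sub>y S)\<close>, so that the flow reads
  \<open>p' = - F p - (p - q) / \<rho>\<close>, \<open>q' = (p - q) / \<rho>\<close>. For a saddle point \<open>c\<close> of \<open>S\<close>, convexity
  gives \<open>F u \<bullet> (u - c) \<ge> 0\<close>, so \<open>V = |p - c|\<^sup>2 + |q - c|\<^sup>2\<close> decreases along the flow with
  \<open>V' = - 2 F p \<bullet> (p - c) - 2 |p - q|\<^sup>2 / \<rho>\<close>. Hence trajectories are bounded and, by Barbalat's lemma,
  \<open>V' \<longlongrightarrow> 0\<close> and so \<open>p - q \<longlongrightarrow> 0\<close>. A second application of Barbalat's lemma, to \<open>p - q\<close> itself,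
  gives \<open>F p \<longlongrightarrow> 0\<close>; this replaces LaSalle's principle, which would need solutions of the flow
  starting at limit points. A cluster point of \<open>p\<close> is then a zero of \<open>F\<close>, i.e. a saddle point, and
  taking it for \<open>c\<close> makes \<open>V\<close> tend to \<open>0\<close>.\<close>

section \<open>Limits and uniform continuity along trajectories\<close>

text \<open>On a window of fixed length \<open>h\<close>, uniform continuity keeps \<open>f'\<close>
  within \<open>e / 2\<close> of \<open>f' t\<close>, so the increment of \<open>f\<close> differs
  from \<open>h *\<^sub>R f' t\<close> by at most \<open>h * (e / 2)\<close>. Convergence of
  \<open>f\<close> makes that increment eventually smaller than \<open>h * (e / 2)\<close> as well.
  Vector values allow the use on both \<open>V\<close> and \<open>p - q\<close>.\<close>

lemma barbalat:
  fixes f f' :: "real \<Rightarrow> 'a::real_normed_vector"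
  assumes deriv: "\<And>t. t \<ge> 0 \<Longrightarrow> (f has_vector_derivative f' t) (at t within {0..})"
    and uc: "uniformly_continuous_on {0..} f'"
    and lim: "(f \<longlongrightarrow> l) at_top"
  shows "(f' \<longlongrightarrow> 0) at_top"
proof (rule tendstoI)
  fix e :: real assume e: "e > 0"
  obtain d where d: "d > 0"
    and close: "\<And>s t. s \<ge> 0 \<Longrightarrow> t \<ge> 0 \<Longrightarrow> dist s t < d \<Longrightarrow> dist (f' s) (f' t) < e / 2"
    using uniformly_continuous_onE[OF uc half_gt_zero[OF e]] by (metis atLeast_iff)
  define h where "h = d / 2"
  have h: "0 < h" "h < d" using d by (auto simp: h_def)
  have "((\<lambda>t. f (t + h)) \<longlongrightarrow> l) at_top"
    using filterlim_tendsto_add_at_top[OF tendsto_const filterlim_ident, of h]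
    by (intro filterlim_compose[OF lim]) (simp add: add.commute)
  then have "((\<lambda>t. norm (f (t + h) - f t)) \<longlongrightarrow> norm (l - l)) at_top"
    by (intro tendsto_norm tendsto_diff lim)
  then have "\<forall>\<^sub>F t in at_top. norm (f (t + h) - f t) < h * (e / 2)"
    using h e by (intro order_tendstoD(2)) auto
  moreover have "\<forall>\<^sub>F t in at_top. t \<ge> (0::real)" by (rule eventually_ge_at_top)
  ultimately show "\<forall>\<^sub>F t in at_top. dist (f' t) 0 < e"
  proof eventually_elim
    case (elim t)
    have "norm (f (t + h) - f t - (t + h - t) *\<^sub>R f' t) \<le> norm (t + h - t) * (e / 2)"
    proof (rule vector_differentiable_bound_linearization[where S = "{t..t + h}"])
      show "(f has_vector_derivative f' s) (at s within {t..t + h})" if "s \<in> {t..t + h}" for s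
        using that elim by (intro has_vector_derivative_within_subset[OF deriv]) auto
      show "closed_segment t (t + h) \<subseteq> {t..t + h}"
        using h by (auto simp: closed_segment_eq_real_ivl)
      show "norm (f' s - f' t) \<le> e / 2" if "s \<in> {t..t + h}" for s
        using close[of s t] that elim h by (auto simp: dist_norm)
    qed (use h in auto)
    then have le: "norm (f (t + h) - f t - h *\<^sub>R f' t) \<le> h * (e / 2)"
      using h by simp
    have "norm (h *\<^sub>R f' t) \<le> norm (f (t + h) - f t) + norm (f (t + h) - f t - h *\<^sub>R f' t)"
      by (metis norm_triangle_sub norm_minus_commute)
    also have "\<dots> < h * e" using elim le by linarith
    finally show ?case using h by simp
  qed
qed

text \<open>Supplies the uniform continuity that \<open>barbalat\<close> requires. The closure of
  the orbit is compact, so the velocity \<open>H\<close> is bounded on it and \<open>s\<close> is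
  Lipschitz, while \<open>G\<close> is uniformly continuous there.\<close>

lemma uniformly_continuous_on_bounded_trajectory:
  fixes s :: "real \<Rightarrow> 'a::euclidean_space" and H :: "'a \<Rightarrow> 'a"
    and G :: "'a \<Rightarrow> 'b::metric_space"
  assumes deriv: "\<And>t. t \<ge> 0 \<Longrightarrow> (s has_vector_derivative H (s t)) (at t within {0..})"
    and bdd: "bounded (s ` {0..})"
    and H: "continuous_on UNIV H" and G: "continuous_on UNIV G"
  shows "uniformly_continuous_on {0..} (\<lambda>t. G (s t))"
proof -
  define K where "K = closure (s ` {0..})"
  have K: "compact K" using bdd by (simp add: K_def compact_closure)
  have sK: "s t \<in> K" if "t \<ge> 0" for t
    unfolding K_def using that by (intro subsetD[OF closure_subset]) auto
  have "bounded (H ` K)"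
    by (intro compact_imp_bounded compact_continuous_image continuous_on_subset[OF H] K) auto
  then obtain B where B: "\<And>u. u \<in> K \<Longrightarrow> norm (H u) \<le> B"
    unfolding bounded_iff by auto
  have "norm (s b - s a) \<le> B * norm (b - a)" if "a \<in> {0..}" "b \<in> {0..}" for a b
  proof (rule differentiable_bound[where S = "{0..}" and f' = "\<lambda>t h. h *\<^sub>R H (s t)"])
    show "(s has_derivative (\<lambda>h. h *\<^sub>R H (s t))) (at t within {0..})" if "t \<in> {0..}" for t
      using deriv[of t] that by (simp add: has_vector_derivative_def)
    show "onorm (\<lambda>h. h *\<^sub>R H (s t)) \<le> B" if "t \<in> {0..}" for t
      using B[OF sK[of t]] that
      by (intro onorm_le) (auto simp: mult.commute[of B] intro: mult_left_mono)
  qed (use that in auto)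
  then have "B-lipschitz_on {0..} s"
    using order_trans[OF norm_ge_zero B[OF sK[of 0]]]
    by (intro lipschitz_onI) (auto simp: dist_norm)
  then have "uniformly_continuous_on {0..} s"
    by (rule lipschitz_on_uniformly_continuous)
  moreover have "uniformly_continuous_on (s ` {0..}) G"
    using compact_uniformly_continuous[OF continuous_on_subset[OF G subset_UNIV] K]
      closure_subset[of "s ` {0..}"]
    unfolding uniformly_continuous_on_def K_def by (meson subsetD)
  ultimately show ?thesis
    by (rule uniformly_continuous_on_compose[unfolded comp_def])
qed

lemma nonincreasing_bounded_below_tendsto:
  fixes V :: "real \<Rightarrow> real"
  assumes mono: "\<And>s t. 0 \<le> s \<Longrightarrow> s \<le> t \<Longrightarrow> V t \<le> V s"
    and lower: "\<And>t. 0 \<le> t \<Longrightarrow> b \<le> V t"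
  obtains l where "(V \<longlongrightarrow> l) at_top"
proof
  define l where "l = (INF t\<in>{0..}. V t)"
  have bdd: "bdd_below (V ` {0..})" using lower by (intro bdd_belowI2) auto
  show "(V \<longlongrightarrow> l) at_top"
  proof (rule order_tendstoI)
    fix a assume "a < l"
    then have "a < V t" if "t \<ge> 0" for t
      using cINF_lower[OF bdd, of t] that by (auto simp: l_def)
    then show "\<forall>\<^sub>F t in at_top. a < V t"
      using eventually_ge_at_top[of "0::real"] by (rule eventually_mono[rotated])
  next
    fix a assume "l < a"
    then obtain s where s: "s \<ge> 0" "V s < a"
      using cINF_less_iff[OF _ bdd] by (auto simp: l_def)
    show "\<forall>\<^sub>F t in at_top. V t < a"
      using eventually_ge_at_top[of s] by eventually_elim (use mono s in fastforce)
  qed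
qed

section \<open>Convergence of the flow for an abstract field\<close>

text \<open>\<open>Z\<close> stands for the set of saddle points. Convexity and concavity enter only
  through \<open>variational\<close> and \<open>zero\<close>, so the dynamical argument never
  mentions \<open>S\<close>.\<close>

lemma proximal_flow_converges:
  fixes F :: "'a::euclidean_space \<Rightarrow> 'a" and p q :: "real \<Rightarrow> 'a"
  assumes F: "continuous_on UNIV F"
    and Z: "Z \<noteq> {}"
    and variational: "\<And>c u. c \<in> Z \<Longrightarrow> F u \<bullet> (u - c) \<ge> 0"
    and zero: "\<And>u. F u = 0 \<Longrightarrow> u \<in> Z"
    and \<rho>: "\<rho> > 0"
    and p: "\<And>t. t \<ge> 0 \<Longrightarrow>
      (p has_vector_derivative - F (p t) - (1 / \<rho>) *\<^sub>R (p t - q t)) (at t within {0..})"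
    and q: "\<And>t. t \<ge> 0 \<Longrightarrow>
      (q has_vector_derivative (1 / \<rho>) *\<^sub>R (p t - q t)) (at t within {0..})"
  obtains c where "c \<in> Z" "(p \<longlongrightarrow> c) at_top" "(q \<longlongrightarrow> c) at_top"
proof -
  define V where "V c t = (p t - c) \<bullet> (p t - c) + (q t - c) \<bullet> (q t - c)" for c t
  define V' where "V' c t = - 2 * (F (p t) \<bullet> (p t - c)) - (2 / \<rho>) * ((p t - q t) \<bullet> (p t - q t))"
    for c t
  have V': "(V c has_vector_derivative V' c t) (at t within {0..})" if "t \<ge> 0" for c t
  proof -
    have sq: "((\<lambda>t. (f t - c) \<bullet> (f t - c)) has_vector_derivative 2 * (f' \<bullet> (f t - c)))
        (at t within {0..})"
      if "(f has_vector_derivative f') (at t within {0..})" for f f'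
    proof -
      have "((\<lambda>t. f t - c) has_vector_derivative f') (at t within {0..})"
        using has_vector_derivative_diff[OF that has_vector_derivative_const] by simp
      from bounded_bilinear.has_vector_derivative[OF bounded_bilinear_inner this this]
      show ?thesis by (simp add: inner_commute)
    qed
    \<comment> \<open>The coupling terms combine to a square: \<open>(p - q) \<bullet> (p - c) - (p
      - q) \<bullet> (q - c) = (p - q) \<bullet> (p - q)\<close>.\<close>
    show ?thesis
      unfolding V_def
      by (rule has_vector_derivative_eq_rhs[OF has_vector_derivative_add
            [OF sq[OF p[OF that]] sq[OF q[OF that]]]])
         (simp add: V'_def inner_simps inner_commute algebra_simps)
  qed
  have V_nonneg: "0 \<le> V c t" for c t by (simp add: V_def)
  have V'_le: "V' c t \<le> 0" if "c \<in> Z" for c t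
    using variational[OF that, of "p t"] \<rho>
      mult_nonneg_nonneg[OF _ inner_ge_zero, of "2 / \<rho>" "p t - q t"]
    by (simp add: V'_def del: inner_ge_zero)
  \<comment> \<open>The derivative at 0 is only one-sided, so monotonicity is tested on the open
    interval, where the derivative is two-sided.\<close>
  have decr: "V c t \<le> V c s" if "c \<in> Z" "0 \<le> s" "s \<le> t" for c s t
  proof (rule DERIV_nonpos_imp_decreasing_open[OF \<open>s \<le> t\<close>])
    show "continuous_on {s..t} (V c)"
      using V' that
      by (intro continuous_on_subset[OF continuous_on_vector_derivative[of "{0..}"]]) auto
    show "\<exists>y. (V c has_real_derivative y) (at r) \<and> y \<le> 0" if "s < r" "r < t" for r
    proof (intro exI conjI)
      show "V' c r \<le> 0" using V'_le \<open>c \<in> Z\<close> .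
      have "at r within {0..} = at r"
        using that \<open>0 \<le> s\<close> by (intro at_within_interior) (auto simp: interior_real_atLeast)
      then show "(V c has_real_derivative V' c r) (at r)"
        using V'[of r c] that \<open>0 \<le> s\<close>
        by (simp add: has_real_derivative_iff_has_vector_derivative)
    qed
  qed
  obtain c0 where c0: "c0 \<in> Z" using Z by auto
  \<comment> \<open>Pairing makes the system autonomous: \<open>V'\<close> and the derivative of
    \<open>p - q\<close> become continuous functions of the state \<open>pq t\<close>.\<close>
  define pq where "pq t = (p t, q t)" for t
  define H where "H = (\<lambda>(u, v). (- F u - (1 / \<rho>) *\<^sub>R (u - v), (1 / \<rho>) *\<^sub>R (u - v)))"
  have F_fst: "continuous_on UNIV (\<lambda>s::'a \<times> 'a. F (fst s))"
    by (intro continuous_on_compose2[OF F] continuous_intros) auto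
  have H: "continuous_on UNIV H"
    unfolding H_def case_prod_beta by (intro continuous_intros F_fst)
  have pq: "(pq has_vector_derivative H (pq t)) (at t within {0..})" if "t \<ge> 0" for t
    unfolding pq_def H_def using that by (auto intro!: has_vector_derivative_Pair p q)
  have bdd: "bounded (pq ` {0..})"
  proof -
    have "norm (pq t - (c0, c0)) \<le> sqrt (V c0 0)" if "t \<ge> 0" for t
      using decr[OF c0 order_refl that]
      by (auto simp: pq_def norm_Pair V_def power2_norm_eq_inner intro!: real_sqrt_le_mono)
    then show ?thesis
      by (intro bounded_subset[OF bounded_cball[of "(c0, c0)" "sqrt (V c0 0)"]])
         (auto simp: dist_norm norm_minus_commute)
  qed
  note uc = uniformly_continuous_on_bounded_trajectory[OF pq bdd H]
  have pq_diff: "((\<lambda>t. p t - q t) \<longlongrightarrow> 0) at_top"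
  proof -
    obtain l where l: "(V c0 \<longlongrightarrow> l) at_top"
      by (rule nonincreasing_bounded_below_tendsto[OF decr[OF c0] V_nonneg])
    have "continuous_on UNIV (\<lambda>s. - 2 * (F (fst s) \<bullet> (fst s - c0))
        - (2 / \<rho>) * ((fst s - snd s) \<bullet> (fst s - snd s)))"
      by (intro continuous_intros F_fst)
    from uc[OF _ this] have "uniformly_continuous_on {0..} (V' c0)"
      by (simp add: pq_def V'_def[abs_def])
    with V' have "(V' c0 \<longlongrightarrow> 0) at_top"
      using l by (intro barbalat) auto
    \<comment> \<open>The factor is chosen so that \<open>- (\<rho> / 2) * V' c0 t\<close> equals
      the squared norm of \<open>p t - q t\<close> plus the nonnegative term
      \<open>\<rho> * (F (p t) \<bullet> (p t - c0))\<close>.\<close>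
    then have "((\<lambda>t. - (\<rho> / 2) * V' c0 t) \<longlongrightarrow> - (\<rho> / 2) * 0) at_top"
      by (intro tendsto_intros)
    then have lim0: "((\<lambda>t. - (\<rho> / 2) * V' c0 t) \<longlongrightarrow> 0) at_top" by simp
    have "((\<lambda>t. (norm (p t - q t))\<^sup>2) \<longlongrightarrow> 0) at_top"
    proof (rule tendsto_sandwich[OF _ _ tendsto_const lim0])
      have "(norm (p t - q t))\<^sup>2 \<le> - (\<rho> / 2) * V' c0 t" for t
        using variational[OF c0, of "p t"] \<rho>
        by (simp add: V'_def power2_norm_eq_inner algebra_simps)
      then show "\<forall>\<^sub>F t in at_top. (norm (p t - q t))\<^sup>2 \<le> - (\<rho> / 2) * V' c0 t" by simp
    qed auto
    then have "((\<lambda>t. sqrt ((norm (p t - q t))\<^sup>2)) \<longlongrightarrow> sqrt 0) at_top"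
      by (rule tendsto_real_sqrt)
    then show ?thesis by (simp add: tendsto_norm_zero_iff)
  qed
  have F_lim: "((\<lambda>t. F (p t)) \<longlongrightarrow> 0) at_top"
  proof -
    \<comment> \<open>The derivative of \<open>p - q\<close>: both equations contribute
      \<open>(1 / \<rho>) *\<^sub>R (p t - q t)\<close>, whence the factor 2. Once \<open>r'\<close>
      and \<open>p - q\<close> vanish in the limit, so does \<open>F p\<close>.\<close>
    define r' where "r' t = - F (p t) - (2 / \<rho>) *\<^sub>R (p t - q t)" for t
    have "(r' \<longlongrightarrow> 0) at_top"
    proof (rule barbalat[OF _ _ pq_diff])
      show "((\<lambda>t. p t - q t) has_vector_derivative r' t) (at t within {0..})" if "t \<ge> 0" for t
        using has_vector_derivative_diff[OF p[OF that] q[OF that]]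
        by (simp add: r'_def algebra_simps flip: scaleR_add_left)
      show "uniformly_continuous_on {0..} r'"
      proof -
        have "continuous_on UNIV (\<lambda>s. - F (fst s) - (2 / \<rho>) *\<^sub>R (fst s - snd s))"
          by (intro continuous_intros F_fst)
        from uc[OF _ this] show ?thesis
          by (simp add: pq_def r'_def[abs_def])
      qed
    qed
    then have "((\<lambda>t. - r' t - (2 / \<rho>) *\<^sub>R (p t - q t)) \<longlongrightarrow> - 0 - (2 / \<rho>) *\<^sub>R 0) at_top"
      by (intro tendsto_intros pq_diff)
    then show ?thesis by (simp add: r'_def)
  qed
  have "compact (closure (pq ` {0..}))" using bdd by (simp add: compact_closure)
  then obtain s k where k: "strict_mono (k :: nat \<Rightarrow> nat)" "(\<lambda>n. pq (real (k n))) \<longlonglongrightarrow> s"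
    using closure_subset[of "pq ` {0..}"]
    by (auto simp: compact_def comp_def dest!: spec[of _ "\<lambda>n. pq (real n)"])
  define c where "c = fst s"
  have k_top: "filterlim (\<lambda>n. real (k n)) at_top sequentially"
    by (intro filterlim_compose[OF filterlim_real_sequentially] filterlim_subseq k)
  have p_c: "(\<lambda>n. p (real (k n))) \<longlonglongrightarrow> c"
    using tendsto_fst[OF k(2)] by (simp add: pq_def c_def)
  have q_c: "(\<lambda>n. q (real (k n))) \<longlonglongrightarrow> c"
    using tendsto_diff[OF p_c filterlim_compose[OF pq_diff k_top]] by simp
  have "(\<lambda>n. F (p (real (k n)))) \<longlonglongrightarrow> F c"
    by (rule continuous_on_tendsto_compose[OF F p_c]) auto
  with filterlim_compose[OF F_lim k_top] have "F c = 0"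
    using LIMSEQ_unique by blast
  then have c: "c \<in> Z" by (rule zero)
  \<comment> \<open>\<open>V\<close> is now centred at the cluster point instead of
    \<open>c0\<close>. Its limit exists by monotonicity, and the times \<open>k n\<close> identify
    it as 0.\<close>
  obtain l where l: "(V c \<longlongrightarrow> l) at_top"
    by (rule nonincreasing_bounded_below_tendsto[OF decr[OF c] V_nonneg])
  have "(\<lambda>n. V c (real (k n))) \<longlonglongrightarrow> (c - c) \<bullet> (c - c) + (c - c) \<bullet> (c - c)"
    unfolding V_def by (intro tendsto_intros p_c q_c)
  with filterlim_compose[OF l k_top] have "l = 0"
    using LIMSEQ_unique by fastforce
  with l have "((\<lambda>t. sqrt (V c t)) \<longlongrightarrow> sqrt 0) at_top"
    by (intro tendsto_real_sqrt) simp
  then have lim0: "((\<lambda>t. sqrt (V c t)) \<longlongrightarrow> 0) at_top" by simp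
  have "(f \<longlongrightarrow> c) at_top" if "\<And>t. norm (f t - c) \<le> sqrt (V c t)" for f
    by (rule LIM_zero_cancel, rule Lim_null_comparison[OF always_eventually lim0])
       (use that in simp)
  then have "(p \<longlongrightarrow> c) at_top" "(q \<longlongrightarrow> c) at_top"
    by (simp_all add: V_def norm_eq_sqrt_inner)
  with c show ?thesis by (rule that)
qed

section \<open>First-order inequalities and the saddle field\<close>

text \<open>Restriction to the line through \<open>u\<close> and \<open>v\<close> reduces this to
  the tangent inequality for a convex function of one real variable, between the parameters 0 and
  1.\<close>

lemma convex_on_gradient_le:
  fixes f :: "'a::real_inner \<Rightarrow> real"
  assumes convex: "convex_on UNIV f" and D: "GDERIV f u :> D"
  shows "f u + D \<bullet> (v - u) \<le> f v"
proof -
  have "convex_on UNIV (\<lambda>t. f (u + t *\<^sub>R (v - u)))"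
  proof (rule convex_onI)
    fix t a b :: real assume "0 < t" "t < 1"
    then have "f ((1 - t) *\<^sub>R (u + a *\<^sub>R (v - u)) + t *\<^sub>R (u + b *\<^sub>R (v - u)))
        \<le> (1 - t) * f (u + a *\<^sub>R (v - u)) + t * f (u + b *\<^sub>R (v - u))"
      by (intro convex_onD[OF convex]) auto
    then show "f (u + ((1 - t) *\<^sub>R a + t *\<^sub>R b) *\<^sub>R (v - u))
        \<le> (1 - t) * f (u + a *\<^sub>R (v - u)) + t * f (u + b *\<^sub>R (v - u))"
      by (simp add: algebra_simps)
  qed auto
  moreover have "((\<lambda>t. f (u + t *\<^sub>R (v - u))) has_real_derivative D \<bullet> (v - u)) (at 0)"
  proof -
    have "((\<lambda>t. u + t *\<^sub>R (v - u)) has_derivative (\<lambda>t. t *\<^sub>R (v - u))) (at 0)"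
      by (auto intro!: derivative_eq_intros)
    moreover have "(f has_derivative (\<lambda>h. h \<bullet> D)) (at (u + 0 *\<^sub>R (v - u)))"
      using D by (simp add: gderiv_def)
    ultimately have "((\<lambda>t. f (u + t *\<^sub>R (v - u))) has_derivative (\<lambda>t. t *\<^sub>R (v - u) \<bullet> D)) (at 0)"
      by (rule has_derivative_compose)
    then show ?thesis
      by (rule has_derivative_imp_has_field_derivative) (simp add: inner_commute)
  qed
  ultimately show ?thesis
    using convex_on_imp_above_tangent[of UNIV "\<lambda>t. f (u + t *\<^sub>R (v - u))" 0 1 "D \<bullet> (v - u)"]
    by simp
qed

lemma concave_on_gradient_ge:
  fixes f :: "'a::real_inner \<Rightarrow> real"
  assumes "concave_on UNIV f" and "GDERIV f u :> D"
  shows "f v \<le> f u + D \<bullet> (v - u)"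
  using convex_on_gradient_le[of "\<lambda>x. - f x" u "- D" v] assms(1) GDERIV_minus[OF assms(2)]
  by (simp add: concave_on_def)

text \<open>The components of \<open>F\<close> are the Riesz representatives of the partial
  derivatives, written out in the basis so that continuity is inherited from \<open>S'\<close>. The
  sign in the second one turns ascent in \<open>y\<close> into descent along
  \<open>F\<close>.\<close>

lemma continuously_differentiable_saddle_field:
  fixes S :: "'a::euclidean_space \<Rightarrow> 'b::euclidean_space \<Rightarrow> real"
  assumes "continuously_differentiable (\<lambda>(u, v). S u v)"
  obtains F where "continuous_on UNIV F"
    and "\<And>u v. GDERIV (\<lambda>u. S u v) u :> fst (F (u, v))"
    and "\<And>u v. GDERIV (\<lambda>v. S u v) v :> - snd (F (u, v))"
proof -
  obtain S' where S': "\<And>p. ((\<lambda>(u, v). S u v) has_derivative blinfun_apply (S' p)) (at p)"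
    and cont: "continuous_on UNIV S'"
    using assms unfolding continuously_differentiable_def by blast
  define F where "F p = (\<Sum>i\<in>Basis. S' p (i, 0) *\<^sub>R i, - (\<Sum>i\<in>Basis. S' p (0, i) *\<^sub>R i))" for p
  have fst_F: "h \<bullet> fst (F p) = S' p (h, 0)" for h p
  proof -
    have "S' p (h, 0) = S' p (\<Sum>i\<in>Basis. (h \<bullet> i) *\<^sub>R (i, 0))"
      by (simp add: sum_prod euclidean_representation)
    then show ?thesis
      by (simp add: F_def inner_sum_right blinfun.sum_right blinfun.scaleR_right mult.commute
          del: scaleR_Pair)
  qed
  have snd_F: "h \<bullet> (- snd (F p)) = S' p (0, h)" for h p
  proof -
    have "S' p (0, h) = S' p (\<Sum>i\<in>Basis. (h \<bullet> i) *\<^sub>R (0, i))"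
      by (simp add: sum_prod euclidean_representation)
    then show ?thesis
      by (simp add: F_def inner_sum_right blinfun.sum_right blinfun.scaleR_right mult.commute
          del: scaleR_Pair)
  qed
  show thesis
  proof
    show "continuous_on UNIV F"
      unfolding F_def by (intro continuous_intros cont)
    show "GDERIV (\<lambda>u. S u v) u :> fst (F (u, v))" for u v
      unfolding gderiv_def fst_F
      using has_derivative_compose[OF has_derivative_Pair[OF has_derivative_ident
            has_derivative_const] S'[of "(u, v)"]] by simp
    show "GDERIV (\<lambda>v. S u v) v :> - snd (F (u, v))" for u v
      unfolding gderiv_def snd_F
      using has_derivative_compose[OF has_derivative_Pair[OF has_derivative_const
            has_derivative_ident] S'[of "(u, v)"]] by simp
  qed
qed

text \<open>Both penalties vanish at the point itself. Varying one side leaves the other penalty at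
  0 and adds a term of the favourable sign.\<close>

lemma saddle_point_regularized:
  fixes S :: "'a::real_normed_vector \<Rightarrow> 'b::real_normed_vector \<Rightarrow> real"
  assumes "saddle_point S xs ys" and "\<rho> > 0"
  shows "saddle_point (regularized S \<rho>) (xs, xs) (ys, ys)"
  unfolding saddle_point_def split_paired_All
proof (intro allI conjI)
  fix x z :: 'a and y w :: 'b
  have saddle: "S xs y \<le> S xs ys" "S xs ys \<le> S x ys"
    using assms(1) by (auto simp: saddle_point_def)
  have nonneg: "0 \<le> 1 / (2 * \<rho>) * r\<^sup>2" for r :: real
    using assms(2) by simp
  show "regularized S \<rho> (xs, xs) (y, w) \<le> regularized S \<rho> (xs, xs) (ys, ys)"
    using saddle(1) nonneg[of "norm (y - w)"] by (simp add: regularized_def)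
  show "regularized S \<rho> (xs, xs) (ys, ys) \<le> regularized S \<rho> (x, z) (ys, ys)"
    using saddle(2) nonneg[of "norm (x - z)"] by (simp add: regularized_def)
qed

section \<open>Application to the regularized saddle flow\<close>

theorem corollary8:
  fixes S :: "real ^ 'n \<Rightarrow> real ^ 'm \<Rightarrow> real"
    and \<rho> :: real
    and x z :: "real \<Rightarrow> real ^ 'n"
    and y w :: "real \<Rightarrow> real ^ 'm"
  assumes "convex_concave S"
    and "continuously_differentiable (\<lambda>(u, v). S u v)"
    and "\<exists>xs ys. saddle_point S xs ys"
    and "\<rho> > 0"
    and "regularized_saddle_flow S \<rho> x z y w"
  shows "\<exists>xs zs ys ws.
           saddle_point (regularized S \<rho>) (xs, zs) (ys, ws) \<and>
           ((\<lambda>t. (x t, z t, y t, w t)) \<longlongrightarrow> (xs, zs, ys, ws)) at_top \<and>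
           saddle_point S xs ys"
proof -
  have convex: "convex_on UNIV (\<lambda>u. S u v)" and concave: "concave_on UNIV (\<lambda>v. S u v)" for u v
    using assms(1) by (auto simp: convex_concave_def)
  obtain F where F: "continuous_on UNIV F"
    and F1: "\<And>u v. GDERIV (\<lambda>u. S u v) u :> fst (F (u, v))"
    and F2: "\<And>u v. GDERIV (\<lambda>v. S u v) v :> - snd (F (u, v))"
    using continuously_differentiable_saddle_field[OF assms(2)] by blast
  define Z where "Z = {(u, v). saddle_point S u v}"
  have variational: "F p \<bullet> (p - c) \<ge> 0" if "c \<in> Z" for c p
  proof -
    obtain a b u v where ab: "c = (a, b)" "p = (u, v)" by fastforce
    \<comment> \<open>Both sides are compared with \<open>S a b\<close>. Adding the two gradient
      inequalities bounds \<open>F p \<bullet> (p - c)\<close> from below by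
      \<open>S u b - S a v\<close>.\<close>
    have "S a v \<le> S u b"
      using that order_trans by (fastforce simp: Z_def ab saddle_point_def)
    with convex_on_gradient_le[OF convex F1, of u v a] concave_on_gradient_ge[OF concave F2, of u b v]
    show ?thesis by (simp add: ab inner_prod_def inner_diff_right)
  qed
  have zero: "p \<in> Z" if "F p = 0" for p
  proof -
    obtain u v where uv: "p = (u, v)" by fastforce
    show ?thesis
      \<comment> \<open>With \<open>F p = 0\<close> the linear terms drop out, and the two gradient
        inequalities become the saddle inequalities.\<close>
      using that convex_on_gradient_le[OF convex F1, of u v] concave_on_gradient_ge[OF concave F2, of u _ v]
      by (simp add: uv Z_def saddle_point_def)
  qed
  have flow: "(x has_vector_derivative - fst (F (x t, y t)) - (1 / \<rho>) *\<^sub>R (x t - z t)) (at t within {0..})"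
    "(z has_vector_derivative (1 / \<rho>) *\<^sub>R (x t - z t)) (at t within {0..})"
    "(y has_vector_derivative - snd (F (x t, y t)) - (1 / \<rho>) *\<^sub>R (y t - w t)) (at t within {0..})"
    "(w has_vector_derivative (1 / \<rho>) *\<^sub>R (y t - w t)) (at t within {0..})"
    if "t \<ge> 0" for t
    using assms(5) that
    by (auto simp: regularized_saddle_flow_def gradient_eqI[OF F1] gradient_eqI[OF F2])
  obtain c where c: "c \<in> Z" "((\<lambda>t. (x t, y t)) \<longlongrightarrow> c) at_top" "((\<lambda>t. (z t, w t)) \<longlongrightarrow> c) at_top"
  proof (rule proximal_flow_converges[OF F _ variational zero \<open>\<rho> > 0\<close>])
    show "Z \<noteq> {}" using assms(3) by (auto simp: Z_def)
    show "((\<lambda>t. (x t, y t)) has_vector_derivative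
        - F (x t, y t) - (1 / \<rho>) *\<^sub>R ((x t, y t) - (z t, w t))) (at t within {0..})" if "t \<ge> 0" for t
      using has_vector_derivative_Pair[OF flow(1,3)[OF that]]
      by (simp add: minus_prod_def uminus_prod_def)
    show "((\<lambda>t. (z t, w t)) has_vector_derivative
        (1 / \<rho>) *\<^sub>R ((x t, y t) - (z t, w t))) (at t within {0..})" if "t \<ge> 0" for t
      using has_vector_derivative_Pair[OF flow(2,4)[OF that]] by simp
  qed
  obtain xs ys where xy: "c = (xs, ys)" by fastforce
  have "saddle_point S xs ys" using c(1) by (simp add: Z_def xy)
  moreover have "((\<lambda>t. (x t, z t, y t, w t)) \<longlongrightarrow> (xs, xs, ys, ys)) at_top"
    using tendsto_fst[OF c(2)] tendsto_snd[OF c(2)] tendsto_fst[OF c(3)] tendsto_snd[OF c(3)]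
    by (intro tendsto_Pair) (simp_all add: xy)
  ultimately show ?thesis
    using saddle_point_regularized[OF _ \<open>\<rho> > 0\<close>] by blast
qed

end
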